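(* For a sequence $a=(a_n)\in\omega$ define the matrix $B=(b_{nk})_{n,k\in\mathbb N_0}$ by $$b_{nk}=\begin{cases}\left[\dfrac{\lambda_kf_{n+1}^2}{(\lambda_k-\lambda_{k-1})f_kf_{k+1}}-\dfrac{\lambda_kf_{n+1}^2}{(\lambda_{k+1}-\lambda_k)f_{k+1}f_{k+2}}\right]a_n,& k<n,\\[10pt] \dfrac{\lambda_kf_{n+1}^2}{(\lambda_k-\lambda_{k-1})f_kf_{k+1}}\,a_n,& k=n,\\[6pt] 0,& k>n.\end{cases}$$ Let $1<p<\infty$, $q=p/(p-1)$, let $\mathcal F$ be the collection of all finite subsets of $\mathbb N_0$, and put $$d_1=\Big\{a\in\omega:\ \sup_{K\in\mathcal F}\sum_k\Big|\sum_{n\in K}b_{nk}\Big|^q<\infty\Big\},\qquad d_2=\Big\{a\in\omega:\ \sup_{k\in\mathbb N_0}\sum_n|b_{nk}|<\infty\Big\}.$$ Then $[\ell_1^{\lambda}(\widehat F)]^{\alpha}=d_2$ and $[\ell_p^{\lambda}(\widehat F)]^{\alpha}=d_1$.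
   Context: $\mathbb N_0=\{0,1,2,\dots\}$; sums without limits run from $0$ to $\infty$; $\omega$ is the space of all real sequences $x=(x_k)_{k\in\mathbb N_0}$. Fibonacci numbers: $f_0=f_1=1$, $f_n=f_{n-1}+f_{n-2}$ for $n\ge 2$. $\lambda=(\lambda_k)_{k\in\mathbb N_0}$ is a fixed strictly increasing sequence of positive reals with $\lambda_k\to\infty$. Terms with negative subscript are $0$ (so $\lambda_{-1}=0$, $x_{-1}=0$). For $x\in\omega$ put $$E_n(x)=\frac1{\lambda_n}\sum_{k=0}^n(\lambda_k-\lambda_{k-1})\Big(\frac{f_k}{f_{k+1}}x_k-\frac{f_{k+1}}{f_k}x_{k-1}\Big),\qquad Ex=(E_n(x))_{n\in\mathbb N_0},$$ and $\ell_p^{\lambda}(\widehat F)=\{x\in\omega: Ex\in\ell_p\}$. The $\alpha$-dual of a sequence space $X$ is $X^\alpha=\{a\in\omega:(a_kx_k)_k\in\ell_1\text{ for all }x\in X\}$. *)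

theory Defs
  imports "HOL-Analysis.Analysis" "HOL-Number_Theory.Fib"
begin

text \<open>
  The library function \<^const>\<open>fib\<close> starts with 0, 1; here the Fibonacci numbers start
  with 1, 1, hence the shift by one (see \<open>fibr_rec\<close> below).
\<close>

definition fibr :: "nat \<Rightarrow> real" where
  "fibr n = real (fib (Suc n))"

lemma fibr_rec: "fibr 0 = 1" "fibr (Suc 0) = 1" "fibr (Suc (Suc n)) = fibr (Suc n) + fibr n"
  by (simp_all add: fibr_def)

text \<open>\<open>prev x k\<close> is $x_{k-1}$ with the convention $x_{-1} = 0$.\<close>

definition prev :: "(nat \<Rightarrow> real) \<Rightarrow> nat \<Rightarrow> real" where
  "prev x k = (if k = 0 then 0 else x (k - 1))"

definition E_trans :: "(nat \<Rightarrow> real) \<Rightarrow> (nat \<Rightarrow> real) \<Rightarrow> nat \<Rightarrow> real" where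
  "E_trans lam x n =
     (1 / lam n) *
     (\<Sum>k=0..n. (lam k - prev lam k) *
        (fibr k / fibr (k + 1) * x k - fibr (k + 1) / fibr k * prev x k))"

definition ell :: "real \<Rightarrow> (nat \<Rightarrow> real) set" where
  "ell p = {x. summable (\<lambda>k. \<bar>x k\<bar> powr p)}"

definition ell_lam_F :: "(nat \<Rightarrow> real) \<Rightarrow> real \<Rightarrow> (nat \<Rightarrow> real) set" where
  "ell_lam_F lam p = {x. E_trans lam x \<in> ell p}"

definition alpha_dual :: "(nat \<Rightarrow> real) set \<Rightarrow> (nat \<Rightarrow> real) set" where
  "alpha_dual X = {a. \<forall>x\<in>X. (\<lambda>k. a k * x k) \<in> ell 1}"

definition B_mat :: "(nat \<Rightarrow> real) \<Rightarrow> (nat \<Rightarrow> real) \<Rightarrow> nat \<Rightarrow> nat \<Rightarrow> real" where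
  "B_mat lam a n k =
     (if k < n then
        (lam k * (fibr (n + 1))\<^sup>2 / ((lam k - prev lam k) * fibr k * fibr (k + 1))
         - lam k * (fibr (n + 1))\<^sup>2 / ((lam (k + 1) - lam k) * fibr (k + 1) * fibr (k + 2))) * a n
      else if k = n then
        lam k * (fibr (n + 1))\<^sup>2 / ((lam k - prev lam k) * fibr k * fibr (k + 1)) * a n
      else 0)"

text \<open>
  The sums and suprema below are taken in \<^typ>\<open>ennreal\<close>, so that divergent series and
  unbounded families have the value \<open>\<infinity>\<close> instead of an unspecified real number.
\<close>

definition d1 :: "(nat \<Rightarrow> real) \<Rightarrow> real \<Rightarrow> (nat \<Rightarrow> real) set" where
  "d1 lam q =
     {a. (SUP K\<in>{K. finite K}. \<Sum>k. ennreal (\<bar>\<Sum>n\<in>K. B_mat lam a n k\<bar> powr q)) < \<infinity>}"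

definition d2 :: "(nat \<Rightarrow> real) \<Rightarrow> (nat \<Rightarrow> real) set" where
  "d2 lam = {a. (SUP k. \<Sum>n. ennreal \<bar>B_mat lam a n k\<bar>) < \<infinity>}"

end

theory Submission
  imports Defs
begin

text \<open>
  The map \<open>E\<close> is a bijection of the space of all sequences, and for \<open>y = E x\<close> one has
  \<open>a\<^sub>n x\<^sub>n = (B y)\<^sub>n\<close>. So \<open>a\<close> lies in the \<open>\<alpha>\<close>-dual iff the lower triangular matrix
  \<open>B\<close> maps \<open>\<ell>\<^sub>p\<close> into \<open>\<ell>\<^sub>1\<close>. Sufficiency of the two conditions is an interchange of sums for
  \<open>p = 1\<close>; for \<open>p > 1\<close> it follows from Young's inequality applied to the sums of rows over the
  indices where \<open>B y\<close> is positive, respectively negative. Necessity is a gliding hump argument: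
  sums of finitely many rows are finitely supported functionals, and if their norms were
  unbounded, a \<open>y \<in> \<ell>\<^sub>p\<close> with unbounded values could be assembled from disjoint blocks.
\<close>

section \<open>Boundedness of partial sums\<close>

lemma ell_iff_bounded_partial_sums:
  "x \<in> ell p \<longleftrightarrow> (\<exists>M. \<forall>N. (\<Sum>k<N. \<bar>x k\<bar> powr p) \<le> M)"
proof
  assume "x \<in> ell p"
  then have "summable (\<lambda>k. \<bar>x k\<bar> powr p)" by (simp add: ell_def)
  then have "(\<Sum>k<N. \<bar>x k\<bar> powr p) \<le> (\<Sum>k. \<bar>x k\<bar> powr p)" for N
    by (intro sum_le_suminf) auto
  then show "\<exists>M. \<forall>N. (\<Sum>k<N. \<bar>x k\<bar> powr p) \<le> M" by blast
next
  assume "\<exists>M. \<forall>N. (\<Sum>k<N. \<bar>x k\<bar> powr p) \<le> M"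
  then obtain M where M: "\<And>N. (\<Sum>k<N. \<bar>x k\<bar> powr p) \<le> M" by blast
  have "summable (\<lambda>k. \<bar>x k\<bar> powr p)"
    by (rule bounded_imp_summable[where B = M])
      (use M[of "Suc _"] in \<open>auto simp: lessThan_Suc_atMost\<close>)
  then show "x \<in> ell p" by (simp add: ell_def)
qed

text \<open>Turns the extended-valued suprema in \<open>d1\<close> and \<open>d2\<close> into
  uniform real bounds on finite sums, the form in which the matrix characterizations below are
  stated.\<close>

lemma SUP_suminf_ennreal_finite_iff:
  fixes f :: "'i \<Rightarrow> nat \<Rightarrow> real"
  assumes nonneg: "\<And>i n. 0 \<le> f i n"
  shows "(SUP i\<in>I. \<Sum>n. ennreal (f i n)) < \<infinity> \<longleftrightarrow> (\<exists>M. \<forall>i\<in>I. \<forall>N. (\<Sum>n<N. f i n) \<le> M)"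
    (is "?S < \<infinity> \<longleftrightarrow> ?R")
proof
  assume fin: "?S < \<infinity>"
  have "(\<Sum>n<N. f i n) \<le> enn2real ?S" if "i \<in> I" for i N
  proof -
    have "ennreal (\<Sum>n<N. f i n) = (\<Sum>n<N. ennreal (f i n))"
      using nonneg by simp
    also have "\<dots> \<le> (\<Sum>n. ennreal (f i n))" by (rule sum_le_suminf) auto
    also have "\<dots> \<le> ?S" using that by (rule SUP_upper)
    also have "\<dots> = ennreal (enn2real ?S)" using fin by simp
    finally show ?thesis by simp
  qed
  then show ?R by blast
next
  assume ?R
  then obtain M where M: "\<And>i N. i \<in> I \<Longrightarrow> (\<Sum>n<N. f i n) \<le> M" by blast
  have "(\<Sum>n. ennreal (f i n)) \<le> ennreal M" if "i \<in> I" for i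
    unfolding suminf_eq_SUP
    by (rule SUP_least) (use nonneg M[OF that] in \<open>simp add: ennreal_leI\<close>)
  then have "?S \<le> ennreal M" by (rule SUP_least)
  then show "?S < \<infinity>" by (rule le_less_trans) simp
qed

text \<open>Split \<open>A\<close> by the sign of \<open>f\<close>: each half is itself an
  admissible \<open>K\<close> whose sum is, up to sign, its sum of absolute values. Hence the factor
  2.\<close>

lemma sum_abs_le_of_subset_sums:
  fixes f :: "'a \<Rightarrow> real"
  assumes "finite A" and bound: "\<And>K. K \<subseteq> A \<Longrightarrow> \<bar>\<Sum>n\<in>K. f n\<bar> \<le> M"
  shows "(\<Sum>n\<in>A. \<bar>f n\<bar>) \<le> 2 * M"
proof -
  let ?P = "{n \<in> A. 0 \<le> f n}" and ?N = "{n \<in> A. \<not> 0 \<le> f n}"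
  have "(\<Sum>n\<in>A. \<bar>f n\<bar>) = (\<Sum>n\<in>?P \<union> ?N. \<bar>f n\<bar>)" by (rule sum.cong) auto
  also have "\<dots> = (\<Sum>n\<in>?P. \<bar>f n\<bar>) + (\<Sum>n\<in>?N. \<bar>f n\<bar>)"
    using \<open>finite A\<close> by (intro sum.union_disjoint) auto
  also have "(\<Sum>n\<in>?P. \<bar>f n\<bar>) = (\<Sum>n\<in>?P. f n)" by (rule sum.cong) auto
  also have "(\<Sum>n\<in>?N. \<bar>f n\<bar>) = - (\<Sum>n\<in>?N. f n)"
    unfolding sum_negf[symmetric] by (rule sum.cong) auto
  finally show ?thesis using bound[of ?P] bound[of ?N] by auto
qed

section \<open>Gliding hump\<close>

text \<open>The vector \<open>y\<close> is built from consecutive blocks. Block \<open>j\<close> has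
  p-mass at most \<open>(1/2) ^ j\<close>; its functional is large on it, vanishes after it, and can
  lose only a controlled amount on earlier blocks because \<open>C\<close> is pointwise bounded.
  Finite supports keep every pairing a finite sum.\<close>

lemma gliding_hump:
  fixes C :: "(nat \<Rightarrow> real) set"
  assumes "0 < p"
    and fin: "\<And>c. c \<in> C \<Longrightarrow> \<exists>m. \<forall>k\<ge>m. c k = 0"
    and bdd: "\<And>k. \<exists>M. \<forall>c\<in>C. \<bar>c k\<bar> \<le> M"
    and hump: "\<And>m \<epsilon> R. 0 < \<epsilon> \<Longrightarrow> \<exists>c\<in>C. \<exists>m' y.
      (\<Sum>k\<in>{m..<m'}. \<bar>y k\<bar> powr p) \<le> \<epsilon> \<and> R \<le> (\<Sum>k\<in>{m..<m'}. c k * y k)"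
  shows "\<exists>y\<in>ell p. \<forall>R. \<exists>c\<in>C. \<exists>m. (\<forall>k\<ge>m. c k = 0) \<and> R \<le> (\<Sum>k<m. c k * y k)"
proof -
  obtain M where M: "\<And>k c. c \<in> C \<Longrightarrow> \<bar>c k\<bar> \<le> M k" using bdd by metis
  \<comment> \<open>A possible block \<open>j\<close> on \<open>{m..<m'}\<close>. With entries of
    modulus at most 1, the earlier blocks cancel at most \<open>\<Sum>k<m. M k\<close>, so this is
    added to the target \<open>j\<close>; since \<open>c\<close> vanishes from \<open>m'\<close> on,
    later blocks do not matter.\<close>
  define H where "H m j c m' y \<longleftrightarrow> c \<in> C \<and> m < m' \<and> (\<forall>k\<ge>m'. c k = 0) \<and> (\<forall>k. \<bar>y k\<bar> \<le> 1)
      \<and> (\<Sum>k\<in>{m..<m'}. \<bar>y k\<bar> powr p) \<le> (1/2) ^ j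
      \<and> real j + (\<Sum>k<m. M k) \<le> (\<Sum>k\<in>{m..<m'}. c k * y k)"
    for m j m' :: nat and c y :: "nat \<Rightarrow> real"
  have "\<exists>c m' y. H m j c m' y" for m j
  proof -
    obtain c m1 y where "c \<in> C" and small: "(\<Sum>k\<in>{m..<m1}. \<bar>y k\<bar> powr p) \<le> (1/2) ^ j"
      and large: "real j + (\<Sum>k<m. M k) \<le> (\<Sum>k\<in>{m..<m1}. c k * y k)"
      using hump[of "(1/2) ^ j"] by (metis zero_less_power half_gt_zero zero_less_one)
    obtain m2 where m2: "\<forall>k\<ge>m2. c k = 0" using fin[OF \<open>c \<in> C\<close>] by blast
    \<comment> \<open>The block is extended past the support of \<open>c\<close>, and
      \<open>Suc\<close> keeps it nonempty even when \<open>m1 \<le> m\<close>. Replacing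
      \<open>y\<close> by its cut-off \<open>z\<close> makes the bound by 1 available at every
      index.\<close>
    define m' where "m' = Suc (max m (max m1 m2))"
    define z where "z k = (if k \<in> {m..<m1} then y k else 0)" for k
    have sub: "{m..<m1} \<subseteq> {m..<m'}" by (auto simp: m'_def)
    \<comment> \<open>An entry above 1 would by itself exceed the p-mass of the block, which is at
      most \<open>(1/2) ^ j \<le> 1\<close>.\<close>
    have "\<bar>z k\<bar> \<le> 1" for k
    proof (rule ccontr)
      assume "\<not> \<bar>z k\<bar> \<le> 1"
      then have k: "k \<in> {m..<m1}" and "1 < \<bar>y k\<bar>" by (auto simp: z_def split: if_splits)
      then have "1 < \<bar>y k\<bar> powr p" using \<open>0 < p\<close> by simp
      also have "\<dots> \<le> (\<Sum>k\<in>{m..<m1}. \<bar>y k\<bar> powr p)" using k by (intro member_le_sum) auto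
      also have "\<dots> \<le> 1" using small by (rule order_trans) (simp add: power_le_one)
      finally show False by simp
    qed
    moreover have "(\<Sum>k\<in>{m..<m'}. \<bar>z k\<bar> powr p) = (\<Sum>k\<in>{m..<m1}. \<bar>y k\<bar> powr p)"
      using sub by (intro sum.mono_neutral_cong_right) (auto simp: z_def)
    moreover have "(\<Sum>k\<in>{m..<m'}. c k * z k) = (\<Sum>k\<in>{m..<m1}. c k * y k)"
      using sub by (intro sum.mono_neutral_cong_right) (auto simp: z_def)
    moreover have "m < m'" "\<forall>k\<ge>m'. c k = 0" using m2 by (auto simp: m'_def)
    ultimately have "H m j c m' z" using \<open>c \<in> C\<close> small large by (simp add: H_def)
    then show ?thesis by blast
  qed
  then obtain c m' Y where H: "\<And>m j. H m j (c m j) (m' m j) (Y m j)" by metis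
  then have
    C: "\<And>m j. c m j \<in> C" and lt: "\<And>m j. m < m' m j"
    and c0: "\<And>m j k. m' m j \<le> k \<Longrightarrow> c m j k = 0"
    and Y1: "\<And>m j k. \<bar>Y m j k\<bar> \<le> 1"
    and small: "\<And>m j. (\<Sum>k\<in>{m..<m' m j}. \<bar>Y m j k\<bar> powr p) \<le> (1/2) ^ j"
    and large: "\<And>m j. real j + (\<Sum>k<m. M k) \<le> (\<Sum>k\<in>{m..<m' m j}. c m j k * Y m j k)"
    unfolding H_def by blast+
  define s where "s = rec_nat 0 (\<lambda>j m. m' m j)"
  have s_Suc: "s (Suc j) = m' (s j) j" for j by (simp add: s_def)
  have mono_s: "strict_mono s" by (rule strict_monoI_Suc) (simp add: s_Suc lt)
  \<comment> \<open>The blocks tile the natural numbers, as \<open>s\<close> starts at 0 and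
    increases strictly; the least such \<open>j\<close> is the index of the block containing
    \<open>k\<close>.\<close>
  define y where "y k = (let j = LEAST j. k < s (Suc j) in Y (s j) j k)" for k
  have y_block: "y k = Y (s j) j k" if "k \<in> {s j..<s (Suc j)}" for j k
  proof -
    have "(LEAST j. k < s (Suc j)) = j"
    proof (rule Least_equality)
      show "k < s (Suc j)" using that by simp
      fix i assume "k < s (Suc i)"
      then have "s j < s (Suc i)" using that by auto
      then show "j \<le> i" using strict_mono_less[OF mono_s] by simp
    qed
    then show ?thesis by (simp add: y_def)
  qed
  have y1: "\<bar>y k\<bar> \<le> 1" for k by (simp add: y_def Let_def Y1)
  have split: "(\<Sum>k<s (Suc j). g k) = (\<Sum>k<s j. g k) + (\<Sum>k\<in>{s j..<s (Suc j)}. g k)"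
    for g :: "nat \<Rightarrow> real" and j
    using sum.atLeastLessThan_concat[of 0 "s j" "s (Suc j)" g] lt[of "s j" j]
    by (simp add: s_Suc atLeast0LessThan)
  have "(\<Sum>k<s j. \<bar>y k\<bar> powr p) \<le> (\<Sum>i<j. (1/2) ^ i)" for j
  proof (induction j)
    case 0
    then show ?case by (simp add: s_def)
  next
    case (Suc j)
    have "(\<Sum>k\<in>{s j..<s (Suc j)}. \<bar>y k\<bar> powr p) \<le> (1/2) ^ j"
      using small[of "s j" j] by (simp add: y_block s_Suc[symmetric])
    then show ?case using Suc by (simp add: split)
  qed
  moreover have "(\<Sum>i<j. (1/2) ^ i) \<le> (2::real)" for j by (simp add: sum_gp_strict)
  ultimately have block: "(\<Sum>k<s j. \<bar>y k\<bar> powr p) \<le> 2" for j by (meson order_trans)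
  have "(\<Sum>k<N. \<bar>y k\<bar> powr p) \<le> 2" for N
  proof -
    \<comment> \<open>\<open>N \<le> s N\<close>, so the first \<open>N\<close> entries lie within
      the first \<open>N\<close> blocks.\<close>
    have "(\<Sum>k<N. \<bar>y k\<bar> powr p) \<le> (\<Sum>k<s N. \<bar>y k\<bar> powr p)"
      using strict_mono_imp_increasing[OF mono_s, of N] by (intro sum_mono2) auto
    then show ?thesis using block[of N] by linarith
  qed
  then have "y \<in> ell p" unfolding ell_iff_bounded_partial_sums by blast
  moreover have "\<exists>c\<in>C. \<exists>m. (\<forall>k\<ge>m. c k = 0) \<and> R \<le> (\<Sum>k<m. c k * y k)" for R
  proof -
    obtain j where j: "R \<le> real j" using real_arch_simple by blast
    let ?c = "c (s j) j"
    have "\<bar>\<Sum>k<s j. ?c k * y k\<bar> \<le> (\<Sum>k<s j. M k)"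
    proof (rule order_trans[OF sum_abs sum_mono])
      fix k
      have "\<bar>?c k\<bar> * \<bar>y k\<bar> \<le> M k * 1"
        using M[OF C] y1 by (intro mult_mono) (auto intro: order_trans[OF abs_ge_zero])
      then show "\<bar>?c k * y k\<bar> \<le> M k" by (simp add: abs_mult)
    qed
    moreover have "real j + (\<Sum>k<s j. M k) \<le> (\<Sum>k\<in>{s j..<s (Suc j)}. ?c k * y k)"
      using large[of j "s j"] by (simp add: y_block s_Suc[symmetric])
    ultimately have "R \<le> (\<Sum>k<s (Suc j). ?c k * y k)" using j by (simp add: split)
    moreover have "\<forall>k\<ge>s (Suc j). ?c k = 0" using c0 by (simp add: s_Suc)
    ultimately show ?thesis using C by blast
  qed
  ultimately show ?thesis by blast
qed

section \<open>Triangular matrices mapping into \<open>\<ell>\<^sub>1\<close>\<close>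

text \<open>Row \<open>n\<close> of a triangular matrix ends at column \<open>n\<close>, so this
  finite sum is the whole matrix product and no question of convergence arises.\<close>

definition tri_apply :: "(nat \<Rightarrow> nat \<Rightarrow> real) \<Rightarrow> (nat \<Rightarrow> real) \<Rightarrow> nat \<Rightarrow> real" where
  "tri_apply B y n = (\<Sum>k\<le>n. B n k * y k)"

lemma tri_apply_eq:
  assumes tri: "\<And>n k. n < k \<Longrightarrow> B n k = 0" and "n < m"
  shows "tri_apply B y n = (\<Sum>k<m. B n k * y k)"
  unfolding tri_apply_def using assms by (intro sum.mono_neutral_left) auto

lemma sum_tri_apply:
  assumes tri: "\<And>n k. n < k \<Longrightarrow> B n k = 0" and "finite K" and m: "\<forall>k\<ge>m. (\<Sum>n\<in>K. B n k) = 0"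
  shows "(\<Sum>n\<in>K. tri_apply B y n) = (\<Sum>k<m. (\<Sum>n\<in>K. B n k) * y k)"
proof -
  obtain b where b: "\<And>n. n \<in> K \<Longrightarrow> n < b"
    using \<open>finite K\<close> unfolding finite_nat_set_iff_bounded by blast
  \<comment> \<open>Columns up to \<open>l\<close> cover every row in \<open>K\<close>. Beyond
    \<open>m\<close> individual rows may be nonzero, but their sum vanishes, so the cut to
    \<open>m\<close> is made only after the interchange.\<close>
  define l where "l = max b m"
  have "(\<Sum>n\<in>K. tri_apply B y n) = (\<Sum>n\<in>K. \<Sum>k<l. B n k * y k)"
    by (intro sum.cong tri_apply_eq tri) (use b in \<open>auto simp: l_def less_max_iff_disj\<close>)
  also have "\<dots> = (\<Sum>k<l. (\<Sum>n\<in>K. B n k) * y k)"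
    by (subst sum.swap) (simp add: sum_distrib_right)
  also have "\<dots> = (\<Sum>k<m. (\<Sum>n\<in>K. B n k) * y k)"
    using m by (intro sum.mono_neutral_right) (auto simp: l_def)
  finally show ?thesis .
qed

lemma tri_row_sums_finite_support:
  fixes B :: "nat \<Rightarrow> nat \<Rightarrow> real"
  assumes tri: "\<And>n k. n < k \<Longrightarrow> B n k = 0" and "finite K"
  shows "\<exists>m. \<forall>k\<ge>m. (\<Sum>n\<in>K. B n k) = 0"
proof -
  obtain b where "\<And>n. n \<in> K \<Longrightarrow> n < b"
    using \<open>finite K\<close> unfolding finite_nat_set_iff_bounded by blast
  then have "\<forall>k\<ge>b. (\<Sum>n\<in>K. B n k) = 0" by (auto intro!: sum.neutral tri intro: less_le_trans)
  then show ?thesis by blast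
qed

text \<open>The image of the \<open>k\<close>-th unit vector is column \<open>k\<close>, which is
  therefore absolutely summable. This supplies the pointwise bound required by
  \<open>gliding_hump\<close>.\<close>

lemma tri_column_bounded:
  assumes tri: "\<And>n k. n < k \<Longrightarrow> B n k = 0" and "0 < p"
    and maps: "\<forall>y\<in>ell p. tri_apply B y \<in> ell 1"
  shows "\<exists>M. \<forall>K. finite K \<longrightarrow> (\<Sum>n\<in>K. \<bar>B n k\<bar>) \<le> M"
proof -
  define e where "e i = (if i = k then 1 else 0 :: real)" for i
  have "(\<lambda>i. \<bar>e i\<bar> powr p) = (\<lambda>i. if i = k then 1 else 0)" by (auto simp: e_def)
  then have "e \<in> ell p" using summable_finite[of "{k}" "\<lambda>i. \<bar>e i\<bar> powr p"] by (simp add: ell_def)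
  moreover have "tri_apply B e = (\<lambda>n. B n k)"
    using tri by (auto simp: tri_apply_def e_def fun_eq_iff mult_delta_right)
  ultimately have "(\<lambda>n. B n k) \<in> ell 1" using maps by force
  then have sm: "summable (\<lambda>n. \<bar>B n k\<bar>)" by (simp add: ell_def)
  have "(\<Sum>n\<in>K. \<bar>B n k\<bar>) \<le> (\<Sum>n. \<bar>B n k\<bar>)" if "finite K" for K
    by (rule sum_le_suminf[OF sm that]) simp
  then show ?thesis by blast
qed

text \<open>A substitute for the uniform boundedness principle. If it failed,
  \<open>gliding_hump\<close> applied to the sums of finitely many rows would give some
  \<open>y\<close> for which finite sums of entries of \<open>tri_apply B y\<close> are unbounded,
  although the \<open>ell 1\<close> norm bounds them.\<close>

lemma tri_no_hump:
  assumes tri: "\<And>n k. n < k \<Longrightarrow> B n k = 0" and "0 < p"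
    and maps: "\<forall>y\<in>ell p. tri_apply B y \<in> ell 1"
  shows "\<exists>m \<epsilon> R. 0 < \<epsilon> \<and> (\<forall>K m' y. finite K \<longrightarrow>
    (\<Sum>k\<in>{m..<m'}. \<bar>y k\<bar> powr p) \<le> \<epsilon> \<longrightarrow> (\<Sum>k\<in>{m..<m'}. (\<Sum>n\<in>K. B n k) * y k) < R)"
proof (rule ccontr)
  assume contr: "\<not> ?thesis"
  define C where "C = (\<lambda>K k. \<Sum>n\<in>K. B n k) ` {K. finite K}"
  have "\<exists>y\<in>ell p. \<forall>R. \<exists>c\<in>C. \<exists>m. (\<forall>k\<ge>m. c k = 0) \<and> R \<le> (\<Sum>k<m. c k * y k)"
  proof (rule gliding_hump[OF \<open>0 < p\<close>])
    show "\<exists>m. \<forall>k\<ge>m. c k = 0" if "c \<in> C" for c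
      using that tri_row_sums_finite_support[OF tri] by (auto simp: C_def)
    show "\<exists>M. \<forall>c\<in>C. \<bar>c k\<bar> \<le> M" for k
      using tri_column_bounded[OF tri \<open>0 < p\<close> maps, of k]
      unfolding C_def by (auto intro: order_trans[OF sum_abs])
    show "\<exists>c\<in>C. \<exists>m' y. (\<Sum>k\<in>{m..<m'}. \<bar>y k\<bar> powr p) \<le> \<epsilon> \<and> R \<le> (\<Sum>k\<in>{m..<m'}. c k * y k)"
      if "0 < \<epsilon>" for m \<epsilon> R
    proof -
      have "\<exists>K m' y. finite K \<and> (\<Sum>k\<in>{m..<m'}. \<bar>y k\<bar> powr p) \<le> \<epsilon>
          \<and> R \<le> (\<Sum>k\<in>{m..<m'}. (\<Sum>n\<in>K. B n k) * y k)"
      proof (rule ccontr)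
        assume neg: "\<not> ?thesis"
        have "(\<Sum>k\<in>{m..<m'}. (\<Sum>n\<in>K. B n k) * y k) < R"
          if "finite K" "(\<Sum>k\<in>{m..<m'}. \<bar>y k\<bar> powr p) \<le> \<epsilon>" for K m' y
        proof (rule ccontr)
          assume "\<not> ?thesis"
          then have "R \<le> (\<Sum>k\<in>{m..<m'}. (\<Sum>n\<in>K. B n k) * y k)" by (rule leI)
          with that neg show False by blast
        qed
        with contr \<open>0 < \<epsilon>\<close> show False by blast
      qed
      then obtain K m' y where "finite K" and y: "(\<Sum>k\<in>{m..<m'}. \<bar>y k\<bar> powr p) \<le> \<epsilon>"
        "R \<le> (\<Sum>k\<in>{m..<m'}. (\<Sum>n\<in>K. B n k) * y k)" by blast
      then have "(\<lambda>k. \<Sum>n\<in>K. B n k) \<in> C" by (simp add: C_def)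
      then show ?thesis by (rule bexI[rotated]) (use y in blast)
    qed
  qed
  then obtain y where y: "y \<in> ell p"
    and unb: "\<And>R. \<exists>c\<in>C. \<exists>m. (\<forall>k\<ge>m. c k = 0) \<and> R \<le> (\<Sum>k<m. c k * y k)" by blast
  have sm: "summable (\<lambda>n. \<bar>tri_apply B y n\<bar>)" using maps y by (auto simp: ell_def)
  \<comment> \<open>The added 1 makes the value strictly larger than the norm.\<close>
  obtain K m where K: "finite K" "\<forall>k\<ge>m. (\<Sum>n\<in>K. B n k) = 0"
    and R: "(\<Sum>n. \<bar>tri_apply B y n\<bar>) + 1 \<le> (\<Sum>k<m. (\<Sum>n\<in>K. B n k) * y k)"
    using unb[of "(\<Sum>n. \<bar>tri_apply B y n\<bar>) + 1"] unfolding C_def by auto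
  have "(\<Sum>n\<in>K. tri_apply B y n) \<le> (\<Sum>n\<in>K. \<bar>tri_apply B y n\<bar>)" by (rule sum_mono) simp
  also have "\<dots> \<le> (\<Sum>n. \<bar>tri_apply B y n\<bar>)" by (rule sum_le_suminf[OF sm \<open>finite K\<close>]) simp
  finally show False using R sum_tri_apply[OF tri K, of y] by simp
qed

text \<open>For necessity, columns from the \<open>m\<close> of \<open>tri_no_hump\<close> on are
  tested with scaled unit vectors, and the finitely many earlier ones are bounded one by
  one.\<close>

lemma tri_maps_ell1_ell1_iff:
  assumes tri: "\<And>n k. n < k \<Longrightarrow> B n k = 0"
  shows "(\<forall>y\<in>ell 1. tri_apply B y \<in> ell 1) \<longleftrightarrow> (\<exists>M. \<forall>k N. (\<Sum>n<N. \<bar>B n k\<bar>) \<le> M)"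
proof
  assume maps: "\<forall>y\<in>ell 1. tri_apply B y \<in> ell 1"
  obtain m \<epsilon> R where "0 < \<epsilon>" and no_hump: "\<And>K m' y. finite K \<Longrightarrow>
      (\<Sum>k\<in>{m..<m'}. \<bar>y k\<bar> powr 1) \<le> \<epsilon> \<Longrightarrow> (\<Sum>k\<in>{m..<m'}. (\<Sum>n\<in>K. B n k) * y k) < R"
    using tri_no_hump[OF tri zero_less_one maps] by blast
  obtain M where M: "\<And>k K. finite K \<Longrightarrow> (\<Sum>n\<in>K. \<bar>B n k\<bar>) \<le> M k"
    using tri_column_bounded[OF tri zero_less_one maps] by metis
  have "(\<Sum>n<N. \<bar>B n k\<bar>) \<le> max (2 * (R / \<epsilon>)) (\<Sum>i<m. M i)" for k N
  proof (cases "k < m")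
    case True
    have "0 \<le> M i" for i using M[of "{}"] by simp
    then have "M k \<le> (\<Sum>i<m. M i)" using True by (intro member_le_sum) auto
    then show ?thesis using M[of "{..<N}" k] by simp
  next
    case False
    have "\<bar>\<Sum>n\<in>K. B n k\<bar> \<le> R / \<epsilon>" if "K \<subseteq> {..<N}" for K
    proof -
      let ?c = "\<Sum>n\<in>K. B n k"
      \<comment> \<open>The mass of this vector is \<open>\<epsilon>\<close>, or 0 if
        \<open>?c = 0\<close>, and its pairing with the row sum is
        \<open>\<epsilon> * \<bar>?c\<bar>\<close>.\<close>
      define y where "y i = (if i = k then \<epsilon> * sgn ?c else 0)" for i
      have k: "k \<in> {m..<Suc k}" using False by simp
      have "(\<Sum>i\<in>{m..<Suc k}. \<bar>y i\<bar> powr 1) = (\<Sum>i\<in>{m..<Suc k}. if i = k then \<bar>\<epsilon> * sgn ?c\<bar> else 0)"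
        by (rule sum.cong) (auto simp: y_def)
      also have "\<dots> = \<bar>\<epsilon> * sgn ?c\<bar>" using k by simp
      also have "\<dots> \<le> \<epsilon>" using \<open>0 < \<epsilon>\<close> by (simp add: abs_mult sgn_if)
      finally have "(\<Sum>i\<in>{m..<Suc k}. (\<Sum>n\<in>K. B n i) * y i) < R"
        using that finite_subset by (intro no_hump) auto
      also have "(\<Sum>i\<in>{m..<Suc k}. (\<Sum>n\<in>K. B n i) * y i)
          = (\<Sum>i\<in>{m..<Suc k}. if i = k then ?c * (\<epsilon> * sgn ?c) else 0)"
        by (rule sum.cong) (auto simp: y_def)
      also have "\<dots> = ?c * (\<epsilon> * sgn ?c)" using k by simp
      also have "\<dots> = \<epsilon> * \<bar>?c\<bar>" by (simp add: abs_sgn)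
      finally show ?thesis using \<open>0 < \<epsilon>\<close> by (simp add: field_simps)
    qed
    then have "(\<Sum>n<N. \<bar>B n k\<bar>) \<le> 2 * (R / \<epsilon>)"
      by (intro sum_abs_le_of_subset_sums) auto
    then show ?thesis by simp
  qed
  then show "\<exists>M. \<forall>k N. (\<Sum>n<N. \<bar>B n k\<bar>) \<le> M" by blast
next
  assume "\<exists>M. \<forall>k N. (\<Sum>n<N. \<bar>B n k\<bar>) \<le> M"
  then obtain M where M: "\<And>k N. (\<Sum>n<N. \<bar>B n k\<bar>) \<le> M" by blast
  have "0 \<le> M" using M[where N = 0] by simp
  show "\<forall>y\<in>ell 1. tri_apply B y \<in> ell 1"
  proof
    fix y assume "y \<in> ell 1"
    then obtain S where S: "\<And>N. (\<Sum>k<N. \<bar>y k\<bar>) \<le> S"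
      by (auto simp: ell_iff_bounded_partial_sums)
    have "(\<Sum>n<N. \<bar>tri_apply B y n\<bar>) \<le> M * S" for N
    proof -
      \<comment> \<open>By triangularity the first \<open>N\<close> rows see only the first
        \<open>N\<close> columns, so both sums are finite and can be interchanged.\<close>
      have "(\<Sum>n<N. \<bar>tri_apply B y n\<bar>) \<le> (\<Sum>n<N. \<Sum>k<N. \<bar>B n k\<bar> * \<bar>y k\<bar>)"
      proof (rule sum_mono)
        fix n assume "n \<in> {..<N}"
        then have "tri_apply B y n = (\<Sum>k<N. B n k * y k)" using tri_apply_eq[OF tri] by auto
        then show "\<bar>tri_apply B y n\<bar> \<le> (\<Sum>k<N. \<bar>B n k\<bar> * \<bar>y k\<bar>)"
          using sum_abs[of "\<lambda>k. B n k * y k" "{..<N}"] by (simp add: abs_mult)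
      qed
      also have "\<dots> = (\<Sum>k<N. (\<Sum>n<N. \<bar>B n k\<bar>) * \<bar>y k\<bar>)"
        by (subst sum.swap) (simp add: sum_distrib_right)
      also have "\<dots> \<le> (\<Sum>k<N. M * \<bar>y k\<bar>)" by (intro sum_mono mult_right_mono M) auto
      also have "\<dots> \<le> M * S"
        unfolding sum_distrib_left[symmetric] by (rule mult_left_mono[OF S \<open>0 \<le> M\<close>])
      finally show ?thesis .
    qed
    then show "tri_apply B y \<in> ell 1" by (auto simp: ell_iff_bounded_partial_sums)
  qed
qed

section \<open>Maps from the p-summable sequences for \<open>1 < p\<close>: conjugate exponents and
  finite row sums\<close>

lemma conjugate_exponent:
  fixes p q :: real
  assumes "1 < p" "q = p / (p - 1)"
  shows "1 < q" "1 / p + 1 / q = 1" "(q - 1) * p = q"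
proof -
  show "1 < q" using assms by simp
  have "1 / p + (p - 1) / p = 1" using assms(1) by (simp add: add_divide_distrib[symmetric])
  then show "1 / p + 1 / q = 1" by (simp add: assms(2))
  have "q * (p - 1) = p" using assms by simp
  then show "(q - 1) * p = q" by (simp add: algebra_simps)
qed

text \<open>The witness is the equality case of Hoelder's inequality.\<close>

lemma holder_extremal:
  fixes c :: "'a \<Rightarrow> real" and I :: "'a set" and p q \<epsilon> :: real
  assumes "1 < p" "q = p / (p - 1)" "0 \<le> \<epsilon>"
  defines "A \<equiv> \<Sum>k\<in>I. \<bar>c k\<bar> powr q"
  assumes "0 < A"
  shows "\<exists>y. (\<Sum>k\<in>I. \<bar>y k\<bar> powr p) \<le> \<epsilon> \<and> (\<Sum>k\<in>I. c k * y k) = \<epsilon> powr (1 / p) * A powr (1 / q)"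
proof -
  have pq: "(q - 1) * p = q" "1 - 1 / p = 1 / q" using conjugate_exponent[OF assms(1,2)] by auto
  \<comment> \<open>Scaled so that the p-mass is exactly \<open>\<epsilon>\<close>: since
    \<open>(q - 1) * p = q\<close>, it equals \<open>t powr p * A\<close>.\<close>
  define t where "t = (\<epsilon> / A) powr (1 / p)"
  define y where "y k = t * (sgn (c k) * \<bar>c k\<bar> powr (q - 1))" for k
  have "t powr p = \<epsilon> / A" using assms by (simp add: t_def powr_powr)
  moreover have "\<bar>y k\<bar> powr p = t powr p * \<bar>c k\<bar> powr q" for k
  proof -
    have "\<bar>y k\<bar> = t * \<bar>c k\<bar> powr (q - 1)"
      by (cases "c k = 0") (simp_all add: y_def t_def abs_mult abs_sgn_eq)
    then show ?thesis by (simp add: powr_mult powr_powr pq t_def)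
  qed
  ultimately have "(\<Sum>k\<in>I. \<bar>y k\<bar> powr p) = \<epsilon>"
    using \<open>0 < A\<close> unfolding A_def by (simp flip: sum_distrib_left sum_divide_distrib)
  moreover have "c k * y k = t * \<bar>c k\<bar> powr q" for k
  proof (cases "c k = 0")
    case False
    then have "\<bar>c k\<bar> * \<bar>c k\<bar> powr (q - 1) = \<bar>c k\<bar> powr q" by (simp add: powr_diff)
    moreover have "c k * y k = t * (\<bar>c k\<bar> * \<bar>c k\<bar> powr (q - 1))" by (simp add: y_def abs_sgn)
    ultimately show ?thesis by simp
  qed (simp add: y_def)
  then have "(\<Sum>k\<in>I. c k * y k) = t * A" by (simp add: A_def sum_distrib_left)
  moreover have "t * A = \<epsilon> powr (1 / p) * A powr (1 / q)"
  proof -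
    have "A powr (1 / q) = A / A powr (1 / p)"
      using \<open>0 < A\<close> by (simp add: pq(2)[symmetric] powr_diff)
    then show ?thesis using assms by (simp add: t_def powr_divide)
  qed
  ultimately show ?thesis by (intro exI[of _ y]) simp
qed

text \<open>For necessity, extremal vectors on \<open>{m..<N}\<close> turn the absence of humps into
  a bound on the q-th powers there, uniform in \<open>K\<close> and \<open>N\<close>; the columns
  below \<open>m\<close> are bounded separately.\<close>

lemma tri_maps_ellp_ell1_iff:
  assumes tri: "\<And>n k. n < k \<Longrightarrow> B n k = 0" and "1 < p" "q = p / (p - 1)"
  shows "(\<forall>y\<in>ell p. tri_apply B y \<in> ell 1) \<longleftrightarrow>
    (\<exists>M. \<forall>K\<in>{K. finite K}. \<forall>N. (\<Sum>k<N. \<bar>\<Sum>n\<in>K. B n k\<bar> powr q) \<le> M)"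
proof
  have "0 < p" "0 < q" using assms by auto
  assume maps: "\<forall>y\<in>ell p. tri_apply B y \<in> ell 1"
  obtain m \<epsilon> R where "0 < \<epsilon>" and no_hump: "\<And>K m' y. finite K \<Longrightarrow>
      (\<Sum>k\<in>{m..<m'}. \<bar>y k\<bar> powr p) \<le> \<epsilon> \<Longrightarrow> (\<Sum>k\<in>{m..<m'}. (\<Sum>n\<in>K. B n k) * y k) < R"
    using tri_no_hump[OF tri \<open>0 < p\<close> maps] by blast
  obtain M where M: "\<And>k K. finite K \<Longrightarrow> (\<Sum>n\<in>K. \<bar>B n k\<bar>) \<le> M k"
    using tri_column_bounded[OF tri \<open>0 < p\<close> maps] by metis
  \<comment> \<open>Solving \<open>\<epsilon> powr (1 / p) * A powr (1 / q) < R\<close> for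
    \<open>A\<close> gives this bound.\<close>
  define T where "T = (R / \<epsilon> powr (1 / p)) powr q"
  have "(\<Sum>k<N. \<bar>\<Sum>n\<in>K. B n k\<bar> powr q) \<le> (\<Sum>k<m. M k powr q) + T" if "finite K" for K N
  proof -
    let ?c = "\<lambda>k. \<bar>\<Sum>n\<in>K. B n k\<bar> powr q"
    let ?A = "\<Sum>k\<in>{m..<N}. ?c k"
    have "?A \<le> T"
    proof (cases "0 < ?A")
      case True
      obtain y where "(\<Sum>k\<in>{m..<N}. \<bar>y k\<bar> powr p) \<le> \<epsilon>"
        "(\<Sum>k\<in>{m..<N}. (\<Sum>n\<in>K. B n k) * y k) = \<epsilon> powr (1 / p) * ?A powr (1 / q)"
        using holder_extremal[OF assms(2,3) less_imp_le[OF \<open>0 < \<epsilon>\<close>] True] by blast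
      then have "\<epsilon> powr (1 / p) * ?A powr (1 / q) < R" using no_hump[OF that] by metis
      then have "?A powr (1 / q) < R / \<epsilon> powr (1 / p)" using \<open>0 < \<epsilon>\<close> by (simp add: field_simps)
      then have "(?A powr (1 / q)) powr q \<le> T"
        unfolding T_def using \<open>0 < q\<close> by (intro powr_mono2) auto
      then show ?thesis using True \<open>0 < q\<close> by (simp add: powr_powr)
    next
      case False
      moreover have "0 \<le> T" by (simp add: T_def)
      ultimately show ?thesis by linarith
    qed
    moreover have "(\<Sum>k<m. ?c k) \<le> (\<Sum>k<m. M k powr q)"
      using \<open>0 < q\<close> by (intro sum_mono powr_mono2 order_trans[OF sum_abs M[OF that]]) auto
    \<comment> \<open>Only an inclusion of index sets, because \<open>N\<close> may be smaller than
      \<open>m\<close>.\<close>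
    moreover have "(\<Sum>k<N. ?c k) \<le> (\<Sum>k\<in>{..<m} \<union> {m..<N}. ?c k)" by (rule sum_mono2) auto
    moreover have "(\<Sum>k\<in>{..<m} \<union> {m..<N}. ?c k) = (\<Sum>k<m. ?c k) + ?A"
      by (rule sum.union_disjoint) auto
    ultimately show ?thesis by linarith
  qed
  then show "\<exists>M. \<forall>K\<in>{K. finite K}. \<forall>N. (\<Sum>k<N. \<bar>\<Sum>n\<in>K. B n k\<bar> powr q) \<le> M" by blast
next
  have "1 < q" "1 / p + 1 / q = 1" "0 < p"
    using conjugate_exponent[OF assms(2,3)] \<open>1 < p\<close> by auto
  assume "\<exists>M. \<forall>K\<in>{K. finite K}. \<forall>N. (\<Sum>k<N. \<bar>\<Sum>n\<in>K. B n k\<bar> powr q) \<le> M"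
  then obtain M where M: "\<And>K N. finite K \<Longrightarrow> (\<Sum>k<N. \<bar>\<Sum>n\<in>K. B n k\<bar> powr q) \<le> M" by blast
  show "\<forall>y\<in>ell p. tri_apply B y \<in> ell 1"
  proof
    fix y assume "y \<in> ell p"
    then obtain S where S: "\<And>N. (\<Sum>k<N. \<bar>y k\<bar> powr p) \<le> S"
      by (auto simp: ell_iff_bounded_partial_sums)
    \<comment> \<open>The bound is independent of \<open>K\<close>, so it applies to the indices
      where the entries are positive and to those where they are negative.\<close>
    have K: "\<bar>\<Sum>n\<in>K. tri_apply B y n\<bar> \<le> S / p + M / q" if "finite K" for K
    proof -
      let ?c = "\<lambda>k. \<Sum>n\<in>K. B n k"
      obtain m where "\<forall>k\<ge>m. ?c k = 0" using tri_row_sums_finite_support[of B K, OF tri \<open>finite K\<close>] by blast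
      then have "\<bar>\<Sum>n\<in>K. tri_apply B y n\<bar> = \<bar>\<Sum>k<m. ?c k * y k\<bar>"
        using sum_tri_apply[OF tri \<open>finite K\<close>] by simp
      also have "\<dots> \<le> (\<Sum>k<m. \<bar>y k\<bar> powr p / p + \<bar>?c k\<bar> powr q / q)"
      proof (rule order_trans[OF sum_abs sum_mono])
        fix k
        show "\<bar>?c k * y k\<bar> \<le> \<bar>y k\<bar> powr p / p + \<bar>?c k\<bar> powr q / q"
          using Youngs_inequality[of p q "\<bar>y k\<bar>" "\<bar>?c k\<bar>"] \<open>1 < p\<close> \<open>1 < q\<close> \<open>1 / p + 1 / q = 1\<close>
          by (simp add: abs_mult mult.commute)
      qed
      also have "\<dots> = (\<Sum>k<m. \<bar>y k\<bar> powr p) / p + (\<Sum>k<m. \<bar>?c k\<bar> powr q) / q"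
        by (simp add: sum.distrib sum_divide_distrib)
      also have "\<dots> \<le> S / p + M / q"
        using \<open>0 < p\<close> \<open>1 < q\<close> by (intro add_mono divide_right_mono S M that) auto
      finally show ?thesis .
    qed
    have "(\<Sum>n<N. \<bar>tri_apply B y n\<bar>) \<le> 2 * (S / p + M / q)" for N
      by (rule sum_abs_le_of_subset_sums) (auto intro!: K intro: finite_subset)
    then show "tri_apply B y \<in> ell 1" by (auto simp: ell_iff_bounded_partial_sums)
  qed
qed

section \<open>Inversion of \<open>E\<close>\<close>

lemma fibr_pos: "0 < fibr n"
  by (simp add: fibr_def fib_neq_0_nat)

text \<open>With \<open>w k = x k / (fibr (k + 1))\<^sup>2\<close> the bracket in
  \<open>E_trans\<close> is \<open>fibr k * fibr (k + 1) * (w k - prev w k)\<close>. Inverting thus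
  means differencing \<open>lam * y\<close>, dividing by the weights, summing up to get
  \<open>w\<close>, and rescaling.\<close>

definition E_inv :: "(nat \<Rightarrow> real) \<Rightarrow> (nat \<Rightarrow> real) \<Rightarrow> nat \<Rightarrow> real" where
  "E_inv lam y n = (fibr (n + 1))\<^sup>2 *
     (\<Sum>j\<le>n. (lam j * y j - prev (\<lambda>i. lam i * y i) j) / ((lam j - prev lam j) * fibr j * fibr (j + 1)))"

lemma summation_by_parts:
  fixes u v :: "nat \<Rightarrow> real"
  shows "(\<Sum>j\<le>n. u j * (v j - prev v j)) = (\<Sum>k<n. (u k - u (k + 1)) * v k) + u n * v n"
  by (induction n) (simp_all add: prev_def algebra_simps)

text \<open>Summation by parts moves the differences from \<open>lam * y\<close> to the reciprocal
  weights \<open>u\<close>. This yields the two-term entries of \<open>B_mat\<close> below the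
  diagonal, and the boundary term is the diagonal entry.\<close>

lemma B_mat_apply: "tri_apply (B_mat lam a) y n = a n * E_inv lam y n"
proof -
  define u where "u k = 1 / ((lam k - prev lam k) * fibr k * fibr (k + 1))" for k
  define v where "v = (\<lambda>k. lam k * y k)"
  have "E_inv lam y n = (fibr (n + 1))\<^sup>2 * (\<Sum>j\<le>n. u j * (v j - prev v j))"
    by (simp add: E_inv_def u_def v_def)
  moreover have "(\<Sum>k<n. B_mat lam a n k * y k) = (\<Sum>k<n. a n * (fibr (n + 1))\<^sup>2 * ((u k - u (k + 1)) * v k))"
    by (rule sum.cong) (simp_all add: B_mat_def u_def v_def prev_def algebra_simps)
  moreover have "B_mat lam a n n * y n = a n * (fibr (n + 1))\<^sup>2 * (u n * v n)"
    by (simp add: B_mat_def u_def v_def)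
  moreover have "tri_apply (B_mat lam a) y n = (\<Sum>k<n. B_mat lam a n k * y k) + B_mat lam a n n * y n"
    by (simp add: tri_apply_def lessThan_Suc_atMost[symmetric])
  ultimately show ?thesis
    unfolding summation_by_parts by (simp add: sum_distrib_left[symmetric] distrib_left mult.assoc)
qed

lemma prev_less:
  assumes "strict_mono lam" "\<And>k. 0 < lam k"
  shows "prev lam k < lam k"
  using assms by (auto simp: prev_def strict_mono_less)

lemma E_trans_E_inv:
  assumes "strict_mono lam" "\<And>k. 0 < lam k"
  shows "E_trans lam (E_inv lam y) = y"
proof
  fix n
  let ?x = "E_inv lam y"
  let ?v = "\<lambda>i. lam i * y i"
  have "(lam k - prev lam k) * (fibr k / fibr (k + 1) * ?x k - fibr (k + 1) / fibr k * prev ?x k)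
      = ?v k - prev ?v k" for k
  proof -
    \<comment> \<open>The last summand of \<open>E_inv lam y k\<close>; splitting it off gives a
      recursion for \<open>?x\<close> that undoes the bracket in \<open>E_trans\<close>.\<close>
    define d where "d = (?v k - prev ?v k) / ((lam k - prev lam k) * fibr k * fibr (k + 1))"
    have "?x k = (fibr (k + 1))\<^sup>2 * (prev ?x k / (fibr k)\<^sup>2 + d)"
    proof (cases k)
      case 0
      then show ?thesis by (simp add: E_inv_def d_def prev_def)
    next
      case (Suc i)
      then show ?thesis using fibr_pos[of "Suc i"] by (simp add: E_inv_def d_def prev_def)
    qed
    then have "fibr k / fibr (k + 1) * ?x k - fibr (k + 1) / fibr k * prev ?x k = fibr k * fibr (k + 1) * d"
      using fibr_pos[of k] fibr_pos[of "k + 1"] by (simp add: field_simps power2_eq_square)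
    then show ?thesis
      using fibr_pos[of k] fibr_pos[of "k + 1"] prev_less[OF assms, of k] by (simp add: d_def)
  qed
  then have "E_trans lam ?x n = 1 / lam n * (\<Sum>k=0..n. ?v k - prev ?v k)" by (simp add: E_trans_def)
  also have "(\<Sum>k=0..n. ?v k - prev ?v k) = ?v n"
    using summation_by_parts[of "\<lambda>_. 1" ?v n] by (simp add: atLeast0AtMost)
  finally show "E_trans lam ?x n = y n" using assms(2)[of n] by simp
qed

lemma E_inv_E_trans:
  assumes "strict_mono lam" "\<And>k. 0 < lam k"
  shows "E_inv lam (E_trans lam x) = x"
proof
  fix n
  \<comment> \<open>In this normalization each summand of \<open>E_inv\<close> is an increment of
    \<open>w\<close>, and the sum telescopes.\<close>
  define w where "w k = x k / (fibr (k + 1))\<^sup>2" for k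
  let ?z = "\<lambda>k. (lam k - prev lam k) * (fibr k / fibr (k + 1) * x k - fibr (k + 1) / fibr k * prev x k)"
  have v: "lam k * E_trans lam x k = (\<Sum>j=0..k. ?z j)" for k
    using assms(2)[of k] by (simp add: E_trans_def)
  have "(lam j * E_trans lam x j - prev (\<lambda>i. lam i * E_trans lam x i) j)
      / ((lam j - prev lam j) * fibr j * fibr (j + 1)) = w j - prev w j" for j
  proof -
    have "lam j * E_trans lam x j - prev (\<lambda>i. lam i * E_trans lam x i) j = ?z j"
      unfolding v by (cases j) (simp_all add: prev_def v)
    moreover have "prev w j = prev x j / (fibr j)\<^sup>2" by (cases j) (simp_all add: prev_def w_def)
    moreover have "?z j / ((lam j - prev lam j) * fibr j * fibr (j + 1))
        = x j / (fibr (j + 1))\<^sup>2 - prev x j / (fibr j)\<^sup>2"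
      using fibr_pos[of j] fibr_pos[of "j + 1"] prev_less[OF assms, of j]
      by (simp add: mult.assoc) (simp add: field_simps power2_eq_square)
    ultimately show ?thesis by (simp only: w_def)
  qed
  then have "E_inv lam (E_trans lam x) n = (fibr (n + 1))\<^sup>2 * (\<Sum>j\<le>n. w j - prev w j)"
    by (simp add: E_inv_def)
  also have "(\<Sum>j\<le>n. w j - prev w j) = w n" using summation_by_parts[of "\<lambda>_. 1" w n] by simp
  finally show "E_inv lam (E_trans lam x) n = x n" using fibr_pos[of "n + 1"] by (simp add: w_def)
qed

section \<open>The alpha-dual in terms of matrix maps, and the conclusion\<close>

lemma alpha_dual_ell_lam_F_iff:
  assumes "strict_mono lam" "\<And>k. 0 < lam k"
  shows "a \<in> alpha_dual (ell_lam_F lam p) \<longleftrightarrow> (\<forall>y\<in>ell p. tri_apply (B_mat lam a) y \<in> ell 1)"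
proof -
  \<comment> \<open>As \<open>E_trans\<close> and \<open>E_inv\<close> are mutually inverse, the
    space is parametrized by \<open>y \<in> ell p\<close>, and \<open>B_mat_apply\<close> turns the
    products with \<open>a\<close> into \<open>tri_apply (B_mat lam a) y\<close>.\<close>
  have "ell_lam_F lam p = E_inv lam ` ell p"
    unfolding ell_lam_F_def set_eq_iff image_iff mem_Collect_eq
    by (metis E_trans_E_inv[OF assms] E_inv_E_trans[OF assms])
  then show ?thesis by (simp add: alpha_dual_def B_mat_apply[abs_def])
qed

theorem theorem3p4:
  fixes lam :: "nat \<Rightarrow> real" and p q :: real
  assumes "strict_mono lam"
    and "\<And>k. lam k > 0"
    and "filterlim lam at_top sequentially"
    and "1 < p"
    and "q = p / (p - 1)"
  shows "alpha_dual (ell_lam_F lam 1) = d2 lam \<and> alpha_dual (ell_lam_F lam p) = d1 lam q"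
proof -
  have "(\<forall>y\<in>ell 1. tri_apply (B_mat lam a) y \<in> ell 1) \<longleftrightarrow> (\<exists>M. \<forall>k N. (\<Sum>n<N. \<bar>B_mat lam a n k\<bar>) \<le> M)" for a
    by (rule tri_maps_ell1_ell1_iff) (simp add: B_mat_def)
  then have "a \<in> alpha_dual (ell_lam_F lam 1) \<longleftrightarrow> a \<in> d2 lam" for a
    unfolding d2_def mem_Collect_eq alpha_dual_ell_lam_F_iff[OF assms(1,2)]
    by (subst SUP_suminf_ennreal_finite_iff) simp_all
  moreover have "(\<forall>y\<in>ell p. tri_apply (B_mat lam a) y \<in> ell 1) \<longleftrightarrow>
      (\<exists>M. \<forall>K\<in>{K. finite K}. \<forall>N. (\<Sum>k<N. \<bar>\<Sum>n\<in>K. B_mat lam a n k\<bar> powr q) \<le> M)" for a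
    by (rule tri_maps_ellp_ell1_iff[OF _ assms(4,5)]) (simp add: B_mat_def)
  then have "a \<in> alpha_dual (ell_lam_F lam p) \<longleftrightarrow> a \<in> d1 lam q" for a
    unfolding d1_def mem_Collect_eq alpha_dual_ell_lam_F_iff[OF assms(1,2)]
    by (subst SUP_suminf_ennreal_finite_iff) simp_all
  ultimately show ?thesis by blast
qed

end
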